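(* There is an absolute constant $c>0$ such that the following holds. Let $s\ge5$ be an integer and let $u_1n+v_1,\dots,u_sn+v_s$ be $s$ arbitrary distinct linear functions with integer coefficients satisfying $u_i\ge1$ and $(u_i,v_i)=1$ for $1\le i\le s$. Then there are at least $c\,\frac{s}{\log s}$ of these functions that constitute an admissible set of linear functions.
   Context: A set $\{u_in+v_i:1\le i\le k\}$ of linear functions with integers $u_i\ge1$ and $v_i$ is called admissible if for each prime $p$ there is some $m_p\in\mathbb{Z}$ such that $p\nmid\prod_{i=1}^k(u_im_p+v_i)$. $(m,n)$ denotes the greatest common divisor. *)

theory Defs
  imports Complex_Main "HOL-Computational_Algebra.Primes"
begin

definition linear_fun :: "int \<Rightarrow> int \<Rightarrow> int \<Rightarrow> int" where
  "linear_fun u v = (\<lambda>n. u * n + v)"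

(* Over the integers, a linear function determines its coefficients, so distinctness
   as functions is distinctness of the pairs (u, v). Finiteness is explicit because
   the product over an infinite set would be 1 by convention. *)
definition admissible :: "(int \<Rightarrow> int) set \<Rightarrow> bool" where
  "admissible F \<longleftrightarrow>
     finite F \<and>
     (\<forall>f\<in>F. \<exists>u v. u \<ge> 1 \<and> f = linear_fun u v) \<and>
     (\<forall>p::nat. prime p \<longrightarrow> (\<exists>m::int. \<not> int p dvd (\<Prod>f\<in>F. f m)))"

end

theory Submission
  imports Defs
begin

text \<open>
  For a prime \<open>p\<close>, a function \<open>u n + v\<close> with \<open>gcd u v = 1\<close> vanishes on at most one residue class
  modulo \<open>p\<close>. So some residue class is bad for at most a proportion \<open>1/p\<close> of the functions; discard
  these. Doing so for all primes \<open>p \<le> s\<close> leaves at least \<open>s \<Prod>(1 - 1/p)\<close> functions, and for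
  \<open>p > s\<close> there are more residue classes than functions. The product is at least of order
  \<open>1 / log s\<close> by an upper bound for \<open>\<Sum>1/p\<close>, obtained by partial summation from
  \<open>\<Sum>log p / p \<le> log n + log 4\<close>, which follows from \<open>\<Prod>p^(n div p) dvd n!\<close> and
  \<open>\<Prod>p \<le> 4^n\<close>.
\<close>

section \<open>Sets of primes up to a bound\<close>

definition primes_upto :: "nat \<Rightarrow> nat set" where
  "primes_upto n = {p. prime p \<and> p \<le> n}"

lemma finite_primes_upto [simp]: "finite (primes_upto n)"
  by (rule finite_subset[of _ "{..n}"]) (auto simp: primes_upto_def)

lemma primes_upto_Suc:
  "primes_upto (Suc n) = (if prime (Suc n) then insert (Suc n) (primes_upto n) else primes_upto n)"
  by (auto simp: primes_upto_def le_Suc_eq)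

lemma Suc_notin_primes_upto [simp]: "Suc n \<notin> primes_upto n"
  by (simp add: primes_upto_def)

lemma sum_primes_upto_Suc:
  "sum f (primes_upto (Suc n)) = (if prime (Suc n) then f (Suc n) else 0) + sum f (primes_upto n)"
  by (simp add: primes_upto_Suc)

lemma primes_upto_0 [simp]: "primes_upto 0 = {}"
  by (auto simp: primes_upto_def dest: prime_gt_0_nat)

lemma primes_upto_1 [simp]: "primes_upto (Suc 0) = {}"
  by (auto simp: primes_upto_def dest: prime_gt_1_nat)

lemma primes_upto_2: "primes_upto 2 = {2}"
  by (auto simp: primes_upto_def dest: prime_gt_1_nat)

section \<open>Prime divisors of factorials and Chebyshev's bound for the primorial\<close>

lemma prod_prime_powers_dvd:
  fixes n :: nat
  assumes "finite P" "\<And>p. p \<in> P \<Longrightarrow> prime p" "\<And>p. p \<in> P \<Longrightarrow> p ^ e p dvd n"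
  shows "(\<Prod>p\<in>P. p ^ e p) dvd n"
  using assms
proof (induction P rule: finite_induct)
  case (insert q P)
  have "coprime (q ^ e q) (\<Prod>p\<in>P. p ^ e p)"
  proof (rule prod_coprime_right)
    fix p assume "p \<in> P"
    then have "p \<noteq> q" "prime p" "prime q" using insert by auto
    then show "coprime (q ^ e q) (p ^ e p)"
      by (simp add: primes_coprime)
  qed
  with insert show ?case
    by (simp add: divides_mult)
qed simp

text \<open>Each of the multiples \<open>p\<close>, \<open>2p\<close>, ..., \<open>kp\<close>
  contributes one factor \<open>p\<close> to the factorial.\<close>

lemma power_dvd_fact_mult: "(p::nat) ^ k dvd fact (p * k)" if "p > 0"
proof (induction k)
  case (Suc k)
  \<comment> \<open>Written as a successor so that \<open>fact_Suc\<close> splits off the last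
    factor \<open>p * Suc k\<close>; what remains is a factorial of at least
    \<open>p * k\<close>.\<close>
  have eq: "p * Suc k = Suc (p * k + p - 1)" using that by simp
  have "p ^ k dvd fact (p * k + p - 1)"
    by (rule dvd_trans[OF Suc fact_dvd]) (use that in simp)
  then have "p ^ k * p dvd fact (p * k + p - 1) * (p * Suc k)"
    by (intro mult_dvd_mono) auto
  also have "\<dots> = fact (p * Suc k)"
    unfolding eq fact_Suc by simp
  finally show ?case by (simp add: mult.commute)
qed simp

lemma prime_powers_dvd_fact: "(\<Prod>p\<in>primes_upto n. p ^ (n div p)) dvd (fact n :: nat)"
proof (rule prod_prime_powers_dvd)
  fix p assume "p \<in> primes_upto n"
  then have "p > 0" by (simp add: primes_upto_def prime_gt_0_nat)
  then show "p ^ (n div p) dvd fact n"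
    by (rule dvd_trans[OF power_dvd_fact_mult fact_dvd]) simp
qed (auto simp: primes_upto_def)

text \<open>Such primes divide the numerator \<open>(2m+1)!\<close> of the binomial coefficient but
  neither factorial \<open>m!\<close> nor \<open>(m+1)!\<close> of its denominator.\<close>

lemma prod_primes_dvd_binomial:
  "(\<Prod>p\<in>{p. prime p \<and> m + 1 < p \<and> p \<le> 2 * m + 1}. p) dvd ((2 * m + 1) choose m)"
    (is "\<Prod>?P dvd _")
proof -
  have "finite ?P" by (rule finite_subset[of _ "{..2 * m + 1}"]) auto
  moreover have "p dvd ((2 * m + 1) choose m)" if "p \<in> ?P" for p
  proof -
    have "fact m * fact (m + 1) * ((2 * m + 1) choose m) = (fact (2 * m + 1) :: nat)"
      using binomial_fact_lemma[of m "2 * m + 1"] by (simp add: mult_2)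
    moreover have "p dvd fact (2 * m + 1)" "\<not> p dvd fact m" "\<not> p dvd fact (m + 1)"
      using that by (subst prime_dvd_fact_iff; simp)+
    ultimately show ?thesis
      using that by (metis (mono_tags, lifting) mem_Collect_eq prime_dvd_mult_iff)
  qed
  ultimately have "(\<Prod>p\<in>?P. p ^ 1) dvd ((2 * m + 1) choose m)"
    by (intro prod_prime_powers_dvd) (blast, blast, simp only: power_one_right)
  then show ?thesis by (simp only: power_one_right)
qed

text \<open>Erdos's argument: for \<open>n = 2m+1\<close> the primes up to \<open>m+1\<close> are
  covered by induction, and the product of the others divides a binomial coefficient that is at most
  \<open>4^m\<close>.\<close>

lemma prod_primes_upto_le: "\<Prod>(primes_upto n) \<le> 4 ^ n"
proof (induction n rule: less_induct)
  case (less n)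
  \<comment> \<open>The condition \<open>m \<ge> 1\<close> ensures \<open>m + 1 < n\<close>, so that
    the induction hypothesis applies.\<close>
  consider "n = 0" | "n = 1" | "n = 2" | "n > 2" "even n" | m where "m \<ge> 1" "n = 2 * m + 1"
    by (cases "n \<le> 2"; cases "even n") (auto elim!: oddE, force)
  then show ?case
  proof cases
    case 1
    then show ?thesis by simp
  next
    case 2
    then show ?thesis by simp
  next
    case 3
    then show ?thesis by (simp add: primes_upto_2)
  next
    case 4
    then have "primes_upto n = primes_upto (n - 1)"
      using primes_upto_Suc[of "n - 1"] prime_odd_nat[of n] by auto
    with less[of "n - 1"] 4 show ?thesis
      by (auto intro: order.trans power_increasing)
  next
    case (5 m)
    let ?P = "{p. prime p \<and> m + 1 < p \<and> p \<le> 2 * m + 1}"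
    have "primes_upto n = primes_upto (m + 1) \<union> ?P"
      using 5 by (auto simp: primes_upto_def)
    moreover have "finite ?P" by (rule finite_subset[of _ "{..2 * m + 1}"]) auto
    moreover have "primes_upto (m + 1) \<inter> ?P = {}" by (auto simp: primes_upto_def)
    ultimately have "\<Prod>(primes_upto n) = \<Prod>(primes_upto (m + 1)) * \<Prod>?P"
      by (simp add: prod.union_disjoint)
    also have "\<dots> \<le> 4 ^ (m + 1) * 4 ^ m"
    proof (rule mult_le_mono)
      show "\<Prod>(primes_upto (m + 1)) \<le> 4 ^ (m + 1)" using less[of "m + 1"] 5 by simp
      have "\<Prod>?P \<le> (2 * m + 1) choose m"
        by (rule dvd_imp_le[OF prod_primes_dvd_binomial]) simp
      \<comment> \<open>By symmetry, the lower half of row \<open>2m+1\<close> of Pascal's triangle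
        sums to half of \<open>2^(2m+1)\<close>.\<close>
      also have "\<dots> \<le> (\<Sum>k\<le>m. (2 * m + 1) choose k)"
        by (rule member_le_sum) auto
      also have "\<dots> = 4 ^ m" using binomial_r_part_sum[of m] by (simp add: power_mult)
      finally show "\<Prod>?P \<le> 4 ^ m" .
    qed
    also have "\<dots> = 4 ^ n" using 5 by (simp add: power_add[symmetric] mult_2)
    finally show ?thesis .
  qed
qed

section \<open>Mertens-type estimates\<close>

text \<open>Taking logarithms of the prime powers dividing \<open>n!\<close>, with
  \<open>n! \<le> n^n\<close>, bounds the sum of \<open>(n div p) * ln p\<close> by
  \<open>n * ln n\<close>. Replacing \<open>n div p\<close> by \<open>n / p\<close> costs at most
  the sum of \<open>ln p\<close>, hence at most \<open>n * ln 4\<close>.\<close>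

lemma sum_ln_prime_div_prime_le:
  assumes "n \<ge> 1"
  shows "(\<Sum>p\<in>primes_upto n. ln (real p) / real p) \<le> ln (real n) + ln 4"
proof -
  let ?P = "primes_upto n"
  have pos: "real p > 0" "real p \<ge> 1" if "p \<in> ?P" for p
    using that prime_ge_1_nat[of p] by (auto simp: primes_upto_def)
  have theta: "(\<Sum>p\<in>?P. ln (real p)) \<le> real n * ln 4"
  proof -
    have "(\<Sum>p\<in>?P. ln (real p)) = ln (real (\<Prod>?P))"
      unfolding of_nat_prod using pos by (intro ln_prod[symmetric]) force+
    also have "\<dots> \<le> ln (4 ^ n)"
    proof (subst ln_le_cancel_iff)
      show "real (\<Prod>?P) > 0" unfolding of_nat_prod using pos by (intro prod_pos) blast
      show "real (\<Prod>?P) \<le> 4 ^ n"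
        using prod_primes_upto_le[of n] by (metis of_nat_le_iff of_nat_numeral of_nat_power)
    qed simp
    finally show ?thesis by (simp add: ln_realpow)
  qed
  have "(\<Sum>p\<in>?P. real (n div p) * ln (real p)) = (\<Sum>p\<in>?P. ln (real (p ^ (n div p))))"
    using pos by (intro sum.cong) (simp_all add: ln_realpow)
  also have "\<dots> = ln (real (\<Prod>p\<in>?P. p ^ (n div p)))"
    unfolding of_nat_prod using pos by (intro ln_prod[symmetric]) force+
  also have "\<dots> \<le> ln (real (n ^ n))"
  proof (subst ln_le_cancel_iff)
    show "real (\<Prod>p\<in>?P. p ^ (n div p)) > 0"
      unfolding of_nat_prod using pos by (intro prod_pos) auto
    have "(\<Prod>p\<in>?P. p ^ (n div p)) \<le> fact n"
      by (rule dvd_imp_le[OF prime_powers_dvd_fact]) simp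
    also have "\<dots> \<le> n ^ n" by (metis fact_le_power of_nat_id)
    finally show "real (\<Prod>p\<in>?P. p ^ (n div p)) \<le> real (n ^ n)" by (rule of_nat_mono)
  qed (use assms in simp)
  also have "\<dots> = real n * ln (real n)" using assms by (simp add: ln_realpow)
  finally have fact: "(\<Sum>p\<in>?P. real (n div p) * ln (real p)) \<le> real n * ln (real n)" .
  have "real n * (\<Sum>p\<in>?P. ln (real p) / real p) =
      (\<Sum>p\<in>?P. (real n / real p) * ln (real p))"
    by (simp add: sum_distrib_left)
  also have "\<dots> \<le> (\<Sum>p\<in>?P. (real (n div p) + 1) * ln (real p))"
  proof (intro sum_mono mult_right_mono)
    fix p assume p: "p \<in> ?P"
    show "real n / real p \<le> real (n div p) + 1"
      using floor_divide_of_nat_eq[of n p, where 'a = real]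
      by linarith
    show "ln (real p) \<ge> 0" using pos[OF p] by simp
  qed
  also have "\<dots> = (\<Sum>p\<in>?P. real (n div p) * ln (real p)) + (\<Sum>p\<in>?P. ln (real p))"
    by (simp add: distrib_right sum.distrib)
  also have "\<dots> \<le> real n * (ln (real n) + ln 4)"
    using fact theta by (simp add: distrib_left)
  finally show ?thesis using assms by simp
qed

text \<open>The induction is Abel summation: a new prime contributes nothing to the left-hand side.\<close>

lemma sum_inverse_primes_abel:
  assumes "n \<ge> 2"
  shows "(\<Sum>p\<in>primes_upto n. 1 / real p) - (\<Sum>p\<in>primes_upto n. ln (real p) / real p) / ln (real n)
    \<le> ln (ln (real n)) - ln (ln 2) + ln 4 * (1 / ln 2 - 1 / ln (real n))"
  using assms
proof (induction n rule: dec_induct)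
  case base
  \<comment> \<open>Both sides vanish at 2.\<close>
  then show ?case by (simp add: primes_upto_2)
next
  case (step n)
  define S where "S = (\<Sum>p\<in>primes_upto n. 1 / real p)"
  define A where "A = (\<Sum>p\<in>primes_upto n. ln (real p) / real p)"
  define x where "x = ln (real n)"
  define y where "y = ln (real (Suc n))"
  have xy: "0 < x" "x < y" using step by (auto simp: x_def y_def)
  have new: "(\<Sum>p\<in>primes_upto (Suc n). 1 / real p)
      - (\<Sum>p\<in>primes_upto (Suc n). ln (real p) / real p) / ln (real (Suc n)) = S - A / y"
    using xy by (simp add: primes_upto_Suc S_def A_def y_def add_divide_distrib del: of_nat_Suc)
  have "A * (1 / x - 1 / y) \<le> (x + ln 4) * (1 / x - 1 / y)"
    using sum_ln_prime_div_prime_le[of n] step xy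
    by (intro mult_right_mono) (auto simp: A_def x_def frac_le)
  also have "\<dots> = 1 - x / y + ln 4 * (1 / x - 1 / y)"
    using xy by (simp add: field_simps)
  \<comment> \<open>This is \<open>ln t \<le> t - 1\<close> at \<open>t = x / y\<close>; the
    right-hand side then telescopes to the iterated logarithm.\<close>
  also have "1 - x / y \<le> ln y - ln x"
    using ln_le_minus_one[of "x / y"] xy by (simp add: ln_div)
  finally have "A / x - A / y \<le> ln y - ln x + ln 4 * (1 / x - 1 / y)"
    by (simp add: right_diff_distrib)
  with step.IH show ?case
    unfolding new unfolding S_def[symmetric] A_def[symmetric] x_def[symmetric] y_def[symmetric]
    by (simp add: right_diff_distrib)
qed

text \<open>The constant 3 is 1 from \<open>ln n / ln n\<close> plus 2 from
  \<open>ln 4 / ln 2\<close>; the two terms \<open>ln 4 / ln n\<close> cancel.\<close>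

lemma sum_inverse_primes_le:
  assumes "n \<ge> 2"
  shows "(\<Sum>p\<in>primes_upto n. 1 / real p) \<le> ln (ln (real n)) + (3 - ln (ln 2))"
proof -
  have "ln (real n) > 0" using assms by simp
  moreover have "(\<Sum>p\<in>primes_upto n. ln (real p) / real p) / ln (real n)
      \<le> (ln (real n) + ln 4) / ln (real n)"
    using sum_ln_prime_div_prime_le[of n] assms by (intro divide_right_mono) auto
  moreover have "ln (4::real) = 2 * ln 2"
    using ln_realpow[of 2 2] by simp
  ultimately show ?thesis
    using sum_inverse_primes_abel[OF assms] by (simp add: add_divide_distrib right_diff_distrib)
qed

text \<open>The differences \<open>1/(k-1) - 1/k\<close>, taken over all integers \<open>k\<close>
  from 2 to \<open>n\<close> and not only the primes, telescope to \<open>1 - 1/n\<close>.\<close>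

lemma sum_primes_inverse_shifted_le:
  assumes "n \<ge> 1"
  shows "(\<Sum>p\<in>primes_upto n. 1 / (real p - 1)) \<le> (\<Sum>p\<in>primes_upto n. 1 / real p) + 1 - 1 / real n"
  using assms
proof (induction n rule: dec_induct)
  case (step n)
  have "1 / real n \<ge> 1 / real (Suc n)" using step by (simp add: frac_le)
  then have "(if prime (Suc n) then 1 / (real (Suc n) - 1) else 0)
      \<le> (if prime (Suc n) then 1 / real (Suc n) else 0) + (1 / real n - 1 / real (Suc n))"
    by simp
  with step.IH show ?case
    unfolding sum_primes_upto_Suc by linarith
qed simp

lemma mertens_product_lower_bound:
  assumes "n \<ge> 2"
  shows "(\<Prod>p\<in>primes_upto n. 1 - 1 / real p) \<ge> exp (ln (ln 2) - 4) / ln (real n)"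
proof -
  let ?P = "primes_upto n"
  \<comment> \<open>The 4 combines the 3 from the sum of \<open>1/p\<close> with the 1 lost in
    passing to \<open>1/(p-1)\<close>.\<close>
  have "exp (ln (ln 2) - 4) / ln (real n) = exp (- (ln (ln (real n)) + (4 - ln (ln 2))))"
    using assms by (simp add: exp_diff exp_minus exp_add field_simps)
  also have "\<dots> \<le> exp (- (\<Sum>p\<in>?P. 1 / (real p - 1)))"
  proof -
    have "1 / real n \<ge> 0" by simp
    then show ?thesis
      using sum_primes_inverse_shifted_le[of n] sum_inverse_primes_le[of n] assms
      unfolding exp_le_cancel_iff by linarith
  qed
  also have "\<dots> = (\<Prod>p\<in>?P. exp (- (1 / (real p - 1))))"
    by (simp add: exp_sum sum_negf[symmetric])
  also have "\<dots> \<le> (\<Prod>p\<in>?P. 1 - 1 / real p)"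
  proof (rule prod_mono, rule conjI)
    fix p assume "p \<in> ?P"
    then have p: "real p > 1" using prime_gt_1_nat[of p] by (simp add: primes_upto_def)
    \<comment> \<open>Bounding the reciprocal of \<open>1 - 1/p\<close> from above turns
      \<open>1 + t \<le> exp t\<close> into a lower bound for the factor.\<close>
    have "real p / (real p - 1) = 1 + 1 / (real p - 1)" using p by (simp add: field_simps)
    also have "\<dots> \<le> exp (1 / (real p - 1))" by (rule exp_ge_add_one_self)
    finally have "inverse (exp (1 / (real p - 1))) \<le> inverse (real p / (real p - 1))"
      using p by (intro le_imp_inverse_le) auto
    then show "exp (- (1 / (real p - 1))) \<le> 1 - 1 / real p"
      using p by (simp add: exp_minus field_simps)
  qed simp
  finally show ?thesis .
qed

section \<open>Sieving by residue classes\<close>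

text \<open>If there is a root, \<open>p\<close> cannot divide \<open>u\<close>, since it would then
  divide \<open>v\<close> too; so \<open>u\<close> is invertible modulo \<open>p\<close> and the
  root is unique.\<close>

lemma card_bad_residues_le:
  fixes u v :: int
  assumes "prime p" "coprime u v"
  shows "card {m\<in>{..<p}. int p dvd u * int m + v} \<le> 1"
proof -
  have "m = m'" if "m < p" "m' < p" "int p dvd u * int m + v" "int p dvd u * int m' + v" for m m'
  proof -
    have "\<not> int p dvd u"
    proof
      assume "int p dvd u"
      moreover from this have "int p dvd v" using that(3) by (simp add: dvd_add_right_iff)
      ultimately have "int p dvd 1" using assms(2) coprime_common_divisor by blast
      then show False using assms(1) by (simp add: prime_nat_iff)
    qed
    moreover have "int p dvd u * (int m - int m')"
      using dvd_diff[OF that(3,4)] by (simp add: algebra_simps)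
    ultimately have "int p dvd int m - int m'"
      using assms(1) by (simp add: prime_dvd_mult_iff)
    then have "int m mod int p = int m' mod int p"
      by (simp add: mod_eq_dvd_iff)
    with that show ?thesis by simp
  qed
  then show ?thesis by (auto simp: card_le_Suc0_iff_eq)
qed

lemma exists_good_residue:
  fixes u v :: "'a \<Rightarrow> int"
  assumes "finite I" "\<And>i. i \<in> I \<Longrightarrow> coprime (u i) (v i)" "prime p"
  shows "\<exists>m<p. p * card {i\<in>I. int p dvd u i * int m + v i} \<le> card I"
proof (rule ccontr)
  let ?bad = "\<lambda>m. {i\<in>I. int p dvd u i * int m + v i}"
  assume "\<not> ?thesis"
  then have gt: "card I < p * card (?bad m)" if "m < p" for m using that by force
  have "p > 0" using assms(3) by (rule prime_gt_0_nat)
  then have "(\<Sum>m<p. card I) < (\<Sum>m<p. p * card (?bad m))"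
    using gt by (intro sum_strict_mono) auto
  also have "\<dots> = p * (\<Sum>m<p. card (?bad m))" by (simp add: sum_distrib_left)
  \<comment> \<open>Double counting of the pairs of a residue and a function that vanishes there;
    each function occurs in at most one pair.\<close>
  also have "(\<Sum>m<p. card (?bad m)) = (\<Sum>i\<in>I. card {m\<in>{..<p}. int p dvd u i * int m + v i})"
    using assms(1) by (intro sum_multicount_gen) auto
  also have "\<dots> \<le> (\<Sum>i\<in>I. 1)"
    using assms by (intro sum_mono card_bad_residues_le) auto
  finally show False by simp
qed

text \<open>Each prime costs at most a proportion \<open>1/p\<close> of the functions still present,
  and residues chosen for earlier primes stay good because the set only shrinks.\<close>

lemma sieve_residues:
  fixes u v :: "'a \<Rightarrow> int"
  assumes "finite P" "\<And>p. p \<in> P \<Longrightarrow> prime p"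
    and "finite I" "\<And>i. i \<in> I \<Longrightarrow> coprime (u i) (v i)"
  shows "\<exists>J\<subseteq>I. real (card J) \<ge> real (card I) * (\<Prod>p\<in>P. 1 - 1 / real p) \<and>
    (\<forall>p\<in>P. \<exists>m. \<forall>i\<in>J. \<not> int p dvd u i * m + v i)"
  using assms(1,2)
proof (induction P rule: finite_induct)
  case empty
  then show ?case by auto
next
  case (insert q P)
  then obtain J where J: "J \<subseteq> I" "real (card J) \<ge> real (card I) * (\<Prod>p\<in>P. 1 - 1 / real p)"
    "\<forall>p\<in>P. \<exists>m. \<forall>i\<in>J. \<not> int p dvd u i * m + v i"
    by auto
  have "finite J" using J(1) assms(3) finite_subset by blast
  have q: "prime q" using insert by simp
  then have "real q > 1" using prime_gt_1_nat by simp
  obtain m where m: "q * card {i\<in>J. int q dvd u i * int m + v i} \<le> card J"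
    using exists_good_residue[of J u v q] \<open>finite J\<close> J(1) assms(4) q by blast
  define B where "B = {i\<in>J. int q dvd u i * int m + v i}"
  have B: "B \<subseteq> J" "finite B" using \<open>finite J\<close> by (auto simp: B_def)
  have "real q * real (card B) \<le> real (card J)"
    using m unfolding B_def by (metis of_nat_le_iff of_nat_mult)
  then have "real (card B) \<le> real (card J) / real q"
    using \<open>real q > 1\<close> by (simp add: field_simps)
  moreover have "real (card (J - B)) = real (card J) - real (card B)"
    using B \<open>finite J\<close> by (simp add: card_Diff_subset card_mono)
  ultimately have "real (card (J - B)) \<ge> real (card J) * (1 - 1 / real q)"
    by (simp add: right_diff_distrib)
  moreover have "real (card J) * (1 - 1 / real q) \<ge>
      real (card I) * (\<Prod>p\<in>P. 1 - 1 / real p) * (1 - 1 / real q)"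
    using J(2) \<open>real q > 1\<close> by (intro mult_right_mono) auto
  ultimately have "real (card (J - B)) \<ge> real (card I) * (\<Prod>p\<in>insert q P. 1 - 1 / real p)"
    using insert by (simp add: mult_ac)
  moreover have "\<exists>m. \<forall>i\<in>J - B. \<not> int p dvd u i * m + v i" if "p \<in> insert q P" for p
  proof (cases "p = q")
    case True
    then show ?thesis by (intro exI[of _ "int m"]) (auto simp: B_def)
  next
    case False
    then show ?thesis using J(3) that by blast
  qed
  ultimately show ?case
    using J(1) by (intro exI[of _ "J - B"]) auto
qed

section \<open>The admissible subset\<close>

theorem lemma7:
  shows "\<exists>c::real. c > 0 \<and>
    (\<forall>(s::nat) (u :: nat \<Rightarrow> int) (v :: nat \<Rightarrow> int).
       s \<ge> 5 \<longrightarrow>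
       (\<forall>i\<in>{1..s}. u i \<ge> 1 \<and> gcd (u i) (v i) = 1) \<longrightarrow>
       inj_on (\<lambda>i. linear_fun (u i) (v i)) {1..s} \<longrightarrow>
       (\<exists>A. A \<subseteq> (\<lambda>i. linear_fun (u i) (v i)) ` {1..s} \<and>
            real (card A) \<ge> c * (real s / ln (real s)) \<and>
            admissible A))"
proof (intro exI[of _ "exp (ln (ln 2) - 4)"] conjI allI impI)
  fix s :: nat and u v :: "nat \<Rightarrow> int"
  let ?f = "\<lambda>i. linear_fun (u i) (v i)"
  assume s: "s \<ge> 5" and uv: "\<forall>i\<in>{1..s}. u i \<ge> 1 \<and> gcd (u i) (v i) = 1"
    and inj: "inj_on ?f {1..s}"
  have cop: "coprime (u i) (v i)" if "i \<in> {1..s}" for i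
    using uv that by (simp add: coprime_iff_gcd_eq_1)
  obtain J where J: "J \<subseteq> {1..s}" "real (card J) \<ge> real s * (\<Prod>p\<in>primes_upto s. 1 - 1 / real p)"
    "\<forall>p\<in>primes_upto s. \<exists>m. \<forall>i\<in>J. \<not> int p dvd u i * m + v i"
  proof -
    have "prime p" if "p \<in> primes_upto s" for p using that by (simp add: primes_upto_def)
    from sieve_residues[of "primes_upto s" "{1..s}" u v, OF _ this _ cop]
    obtain J where "J \<subseteq> {1..s}"
      "real (card J) \<ge> real (card {1..s}) * (\<Prod>p\<in>primes_upto s. 1 - 1 / real p)"
      "\<forall>p\<in>primes_upto s. \<exists>m. \<forall>i\<in>J. \<not> int p dvd u i * m + v i"
      by auto
    then show ?thesis by (intro that[of J]) simp_all
  qed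
  have "finite J" using J(1) finite_subset by blast
  have "card J \<le> s" using card_mono[OF _ J(1)] by simp
  \<comment> \<open>Distinctness of the functions makes the number of selected functions equal to
    the number of selected indices.\<close>
  have injJ: "inj_on ?f J" using inj J(1) inj_on_subset by blast
  have good: "\<exists>m. \<forall>i\<in>J. \<not> int p dvd u i * m + v i" if p: "prime p" for p
  proof (cases "p \<le> s")
    case True
    then show ?thesis using J(3) p by (auto simp: primes_upto_def)
  next
    case False
    obtain m where "p * card {i\<in>J. int p dvd u i * int m + v i} \<le> card J"
      using exists_good_residue[of J u v p] \<open>finite J\<close> J(1) cop p by blast
    \<comment> \<open>As \<open>p > s \<ge> card J\<close>, the averaged bound leaves fewer than one
      bad function, hence none.\<close>
    with False \<open>card J \<le> s\<close> have "p * card {i\<in>J. int p dvd u i * int m + v i} < p * 1"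
      by linarith
    then have "card {i\<in>J. int p dvd u i * int m + v i} = 0" by simp
    then have "{i\<in>J. int p dvd u i * int m + v i} = {}" using \<open>finite J\<close> by simp
    then show ?thesis by blast
  qed
  have "exp (ln (ln 2) - 4) * (real s / ln (real s)) = real s * (exp (ln (ln 2) - 4) / ln (real s))"
    by simp
  also have "\<dots> \<le> real s * (\<Prod>p\<in>primes_upto s. 1 - 1 / real p)"
    using mertens_product_lower_bound[of s] s by (intro mult_left_mono) auto
  also have "\<dots> \<le> real (card (?f ` J))"
    using J(2) injJ by (simp add: card_image)
  finally have "real (card (?f ` J)) \<ge> exp (ln (ln 2) - 4) * (real s / ln (real s))" .
  moreover have "admissible (?f ` J)"
    unfolding admissible_def
  proof (intro conjI allI impI)
    fix p :: nat assume p: "prime p"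
    then obtain m where "\<forall>i\<in>J. \<not> int p dvd u i * m + v i" using good by blast
    \<comment> \<open>A prime divides the product only if it divides a factor, so one residue
      avoiding all roots suffices.\<close>
    then have "\<not> int p dvd (\<Prod>f\<in>?f ` J. f m)"
      using p \<open>finite J\<close> by (subst prime_dvd_prod_iff) (auto simp: linear_fun_def)
    then show "\<exists>m. \<not> int p dvd (\<Prod>f\<in>?f ` J. f m)" ..
  qed (use \<open>finite J\<close> J(1) uv in auto)
  ultimately show "\<exists>A. A \<subseteq> ?f ` {1..s} \<and>
      real (card A) \<ge> exp (ln (ln 2) - 4) * (real s / ln (real s)) \<and> admissible A"
    using J(1) by (intro exI[of _ "?f ` J"]) auto
qed simp

end
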